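(* Let $Y$ and $Z$ be topological spaces. The following statements are true. (1) If $Y$ is a regular locally compact space (or a regular locally $Z$-compact space), then the topologies $t(\tau(t^Z_{co}))$, $t(\tau(t^Z_1))$ and $t(\tau(t^Z_{1,s}))$ on $C(Y,Z)$ are admissible. (2) If $Y$ is a corecompact space (or a $Z$-corecompact space), then the topologies $t(\tau(t^Z_1))$ and $t(\tau(t^Z_{1,s}))$ on $C(Y,Z)$ are admissible. (3) If $Y$ is a locally bounded space (or a locally $Z$-bounded space), then the topology $t(\tau(t^Z_{1,s}))$ on $C(Y,Z)$ is admissible.
   Context: For a topological space $X$, $\mathcal{O}(X)$ denotes the family of all open subsets of $X$. $C(Y,Z)$ is the set of all continuous maps from $Y$ to $Z$, and $\mathcal{O}_Z(Y)=\{f^{-1}(U): f\in C(Y,Z),\ U\in\mathcal{O}(Z)\}$. $\tau_Y^Z$ is the topology on $Y$ having $\mathcal{O}_Z(Y)$ as a subbasis. A subset $K\subseteq Y$ is $Z$-compact if it is compact in $(Y,\tau_Y^Z)$. $Y$ is locally $Z$-compact if $(Y,\tau_Y^Z)$ is locally compact. The topology $t_{co}^Z$ on $C(Y,Z)$ has as a subbasis all sets $(K,U)=\{f\in C(Y,Z): f(K)\subseteq U\}$ with $K\subseteq Y$ $Z$-compact and $U\in\mathcal{O}(Z)$. $\tau_1^Z$ is the family of all $\mathbb{H}\subseteq\mathcal{O}(Y)$ such that: ($\alpha$) if $A\in\mathbb{H}\cap\mathcal{O}_Z(Y)$, $V\in\mathcal{O}(Y)$ and $A\subseteq V$, then $V\in\mathbb{H}$;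 and ($\beta$) every collection of elements of $\mathcal{O}_Z(Y)$ whose union belongs to $\mathbb{H}$ has a finite subcollection whose union belongs to $\mathbb{H}$. $\tau_{1,s}^Z$ is the family of all $\mathbb{H}\subseteq\mathcal{O}(Y)$ satisfying ($\alpha$) and: ($\beta'$) every collection of elements of $\mathcal{O}_Z(Y)$ whose union equals $Y$ has a finite subcollection whose union belongs to $\mathbb{H}$. The topology $t_1^Z$ (respectively $t_{1,s}^Z$) on $C(Y,Z)$ has as a subbasis all sets $(\mathbb{H},U)=\{f\in C(Y,Z): f^{-1}(U)\in\mathbb{H}\}$ with $\mathbb{H}\in\tau_1^Z$ (respectively $\mathbb{H}\in\tau_{1,s}^Z$) and $U\in\mathcal{O}(Z)$. A subset $K$ of a space $X$ is bounded (in $X$) if every open cover of $X$ has a finite subcollection covering $K$. A space $X$ is corecompact if for every $x\in X$ and every open neighborhood $U$ of $x$ there is an open neighborhood $V\subseteq U$ of $x$ that is bounded in the space $U$. $X$ is locally bounded if for every $x\in X$ and every open neighborhood $U$ of $x$ there is a bounded open neighborhood $V\subseteq U$ of $x$. A subset of $Y$ is $Z$-bounded if it is bounded in $(Y,\tau_Y^Z)$. $Y$ is locally $Z$-bounded if for every $y\in Y$ and every open neighborhood $U$ of $y$ there is a $Z$-bounded neighborhood $g^{-1}(V)\in\mathcal{O}_Z(Y)$ of $y$ with $g^{-1}(V)\subseteq U$. $Y$ is $Z$-corecompact if for every $y\in Y$ and every open neighborhood $U$ of $y$ in $Y$ there is a neighborhood $f^{-1}(V)\in\mathcal{O}_Z(Y)$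 of $y$ with $f^{-1}(V)\subseteq U$ and $f^{-1}(V)$ bounded in $U$, where $U$ carries the topology $\{U\cap W: W\in\tau_Y^Z\}$. Dual topologies: for a topology $t$ on $C(Y,Z)$, $\tau(t)$ is the topology on $\mathcal{O}_Z(Y)$ having as a subbasis all sets $(\mathcal{H},U)=\{f^{-1}(U): f\in\mathcal{H}\}$ with $\mathcal{H}\in t$ and $U\in\mathcal{O}(Z)$. For a topology $\tau$ on $\mathcal{O}_Z(Y)$, $t(\tau)$ is the topology on $C(Y,Z)$ having as a subbasis all sets $(\mathbb{H},U)=\{f\in C(Y,Z): f^{-1}(U)\in\mathbb{H}\}$ with $\mathbb{H}\in\tau$ and $U\in\mathcal{O}(Z)$. A topology $t$ on $C(Y,Z)$ is admissible if for every space $X$ and every map $G:X\to C(Y,Z)$, continuity of $G:X\to (C(Y,Z),t)$ implies continuity of $\widetilde{G}:X\times Y\to Z$, $\widetilde{G}(x,y)=G(x)(y)$; equivalently, the evaluation map $e:(C(Y,Z),t)\times Y\to Z$, $e(f,y)=f(y)$, is continuous. *)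

theory Defs
  imports "HOL-Analysis.Analysis"
begin

text \<open>
  Spaces are abstract topologies with an explicit carrier. A continuous map on \<open>Y\<close> is represented
  by the unique function that agrees with it on the carrier of \<open>Y\<close> and is \<open>undefined\<close> outside, so
  that equality in \<open>cmaps Y Z\<close> is equality of maps.
\<close>

definition cmaps :: "'a topology \<Rightarrow> 'b topology \<Rightarrow> ('a \<Rightarrow> 'b) set" where
  "cmaps Y Z = {f. continuous_map Y Z f \<and> f \<in> extensional (topspace Y)}"

definition preim :: "'a topology \<Rightarrow> ('a \<Rightarrow> 'b) \<Rightarrow> 'b set \<Rightarrow> 'a set" where
  "preim Y f U = {y \<in> topspace Y. f y \<in> U}"

text \<open>
  The carrier \<open>S\<close> is given explicitly because the union of the subbasis may be smaller; the empty
  intersection counts as \<open>S\<close>.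
\<close>

definition topology_with_subbasis :: "'a set \<Rightarrow> 'a set set \<Rightarrow> 'a topology" where
  "topology_with_subbasis S \<B> =
     topology (arbitrary union_of (finite intersection_of (\<lambda>B. B \<in> \<B>) relative_to S))"

lemma topspace_topology_with_subbasis [simp]: "topspace (topology_with_subbasis S \<B>) = S"
  by (simp add: topology_with_subbasis_def topspace_subbase)

definition OZ :: "'a topology \<Rightarrow> 'b topology \<Rightarrow> 'a set set" where
  "OZ Y Z = {preim Y f U | f U. f \<in> cmaps Y Z \<and> openin Z U}"

definition tauYZ :: "'a topology \<Rightarrow> 'b topology \<Rightarrow> 'a topology" where
  "tauYZ Y Z = topology_with_subbasis (topspace Y) (OZ Y Z)"

definition Z_compact :: "'a topology \<Rightarrow> 'b topology \<Rightarrow> 'a set \<Rightarrow> bool" where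
  "Z_compact Y Z K \<longleftrightarrow> compactin (tauYZ Y Z) K"

text \<open>
  Local compactness without separation axioms, as usual in the theory of corecompact spaces: the
  compact neighbourhoods of each point form a neighbourhood base. For regular spaces this coincides
  with the existence of one compact neighbourhood of each point (lemma below). The distinction
  matters for \<open>locally_Z_compact\<close>, since \<open>tauYZ Y Z\<close> need not be regular when \<open>Y\<close> is.
\<close>

definition locally_compact_top :: "'a topology \<Rightarrow> bool" where
  "locally_compact_top X \<longleftrightarrow> neighbourhood_base_of (compactin X) X"

lemma locally_compact_top_iff_regular:
  "regular_space X \<Longrightarrow> locally_compact_top X \<longleftrightarrow> locally_compact_space X"
  unfolding locally_compact_top_def
  using locally_compact_space_neighbourhood_base by blast

definition locally_Z_compact :: "'a topology \<Rightarrow> 'b topology \<Rightarrow> bool" where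
  "locally_Z_compact Y Z \<longleftrightarrow> locally_compact_top (tauYZ Y Z)"

definition bounded_in :: "'a topology \<Rightarrow> 'a set \<Rightarrow> bool" where
  "bounded_in X K \<longleftrightarrow> K \<subseteq> topspace X \<and>
     (\<forall>\<U>. (\<forall>U\<in>\<U>. openin X U) \<and> \<Union>\<U> = topspace X \<longrightarrow>
        (\<exists>\<F>\<subseteq>\<U>. finite \<F> \<and> K \<subseteq> \<Union>\<F>))"

definition corecompact :: "'a topology \<Rightarrow> bool" where
  "corecompact X \<longleftrightarrow>
     (\<forall>x\<in>topspace X. \<forall>U. openin X U \<and> x \<in> U \<longrightarrow>
        (\<exists>V. openin X V \<and> x \<in> V \<and> V \<subseteq> U \<and> bounded_in (subtopology X U) V))"

definition locally_bounded :: "'a topology \<Rightarrow> bool" where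
  "locally_bounded X \<longleftrightarrow>
     (\<forall>x\<in>topspace X. \<forall>U. openin X U \<and> x \<in> U \<longrightarrow>
        (\<exists>V. openin X V \<and> x \<in> V \<and> V \<subseteq> U \<and> bounded_in X V))"

definition Z_bounded :: "'a topology \<Rightarrow> 'b topology \<Rightarrow> 'a set \<Rightarrow> bool" where
  "Z_bounded Y Z K \<longleftrightarrow> bounded_in (tauYZ Y Z) K"

definition locally_Z_bounded :: "'a topology \<Rightarrow> 'b topology \<Rightarrow> bool" where
  "locally_Z_bounded Y Z \<longleftrightarrow>
     (\<forall>y\<in>topspace Y. \<forall>U. openin Y U \<and> y \<in> U \<longrightarrow>
        (\<exists>A\<in>OZ Y Z. y \<in> A \<and> A \<subseteq> U \<and> Z_bounded Y Z A))"

definition Z_corecompact :: "'a topology \<Rightarrow> 'b topology \<Rightarrow> bool" where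
  "Z_corecompact Y Z \<longleftrightarrow>
     (\<forall>y\<in>topspace Y. \<forall>U. openin Y U \<and> y \<in> U \<longrightarrow>
        (\<exists>A\<in>OZ Y Z. y \<in> A \<and> A \<subseteq> U \<and> bounded_in (subtopology (tauYZ Y Z) U) A))"

definition t_co :: "'a topology \<Rightarrow> 'b topology \<Rightarrow> ('a \<Rightarrow> 'b) topology" where
  "t_co Y Z = topology_with_subbasis (cmaps Y Z)
     {{f \<in> cmaps Y Z. f ` K \<subseteq> U} | K U. K \<subseteq> topspace Y \<and> Z_compact Y Z K \<and> openin Z U}"

definition cond_alpha :: "'a topology \<Rightarrow> 'b topology \<Rightarrow> 'a set set \<Rightarrow> bool" where
  "cond_alpha Y Z H \<longleftrightarrow>
     (\<forall>A V. A \<in> H \<inter> OZ Y Z \<and> openin Y V \<and> A \<subseteq> V \<longrightarrow> V \<in> H)"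

definition tau1 :: "'a topology \<Rightarrow> 'b topology \<Rightarrow> 'a set set set" where
  "tau1 Y Z = {H. H \<subseteq> Collect (openin Y) \<and> cond_alpha Y Z H \<and>
     (\<forall>\<A>\<subseteq>OZ Y Z. \<Union>\<A> \<in> H \<longrightarrow> (\<exists>\<F>\<subseteq>\<A>. finite \<F> \<and> \<Union>\<F> \<in> H))}"

definition tau1s :: "'a topology \<Rightarrow> 'b topology \<Rightarrow> 'a set set set" where
  "tau1s Y Z = {H. H \<subseteq> Collect (openin Y) \<and> cond_alpha Y Z H \<and>
     (\<forall>\<A>\<subseteq>OZ Y Z. \<Union>\<A> = topspace Y \<longrightarrow> (\<exists>\<F>\<subseteq>\<A>. finite \<F> \<and> \<Union>\<F> \<in> H))}"

definition t_of_family :: "'a topology \<Rightarrow> 'b topology \<Rightarrow> 'a set set set \<Rightarrow> ('a \<Rightarrow> 'b) topology" where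
  "t_of_family Y Z \<T> = topology_with_subbasis (cmaps Y Z)
     {{f \<in> cmaps Y Z. preim Y f U \<in> H} | H U. H \<in> \<T> \<and> openin Z U}"

definition t_1 :: "'a topology \<Rightarrow> 'b topology \<Rightarrow> ('a \<Rightarrow> 'b) topology" where
  "t_1 Y Z = t_of_family Y Z (tau1 Y Z)"

definition t_1s :: "'a topology \<Rightarrow> 'b topology \<Rightarrow> ('a \<Rightarrow> 'b) topology" where
  "t_1s Y Z = t_of_family Y Z (tau1s Y Z)"

definition dual_tau :: "'a topology \<Rightarrow> 'b topology \<Rightarrow> ('a \<Rightarrow> 'b) topology \<Rightarrow> 'a set topology" where
  "dual_tau Y Z t = topology_with_subbasis (OZ Y Z)
     {{preim Y f U | f. f \<in> \<H>} | \<H> U. openin t \<H> \<and> openin Z U}"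

definition dual_t :: "'a topology \<Rightarrow> 'b topology \<Rightarrow> 'a set topology \<Rightarrow> ('a \<Rightarrow> 'b) topology" where
  "dual_t Y Z \<tau> = t_of_family Y Z (Collect (openin \<tau>))"

text \<open>
  HOL cannot quantify over the carrier type of the test spaces \<open>X\<close> inside a formula, so that type is
  a parameter; a theorem about \<open>admissible TYPE('x) Y Z t\<close> with \<open>'x\<close> a type variable covers all of
  them. The topology \<open>t\<close> is meant to have carrier \<open>cmaps Y Z\<close>.
\<close>

definition admissible ::
  "'x itself \<Rightarrow> 'a topology \<Rightarrow> 'b topology \<Rightarrow> ('a \<Rightarrow> 'b) topology \<Rightarrow> bool" where
  "admissible _ Y Z t \<longleftrightarrow>
     (\<forall>(X :: 'x topology) G. continuous_map X t G \<longrightarrow>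
        continuous_map (prod_topology X Y) Z (\<lambda>(x, y). G x y))"

lemma admissible_if_evaluation:
  assumes "continuous_map (prod_topology t Y) Z (\<lambda>(f, y). f y)"
  shows "admissible TYPE('x) Y Z t"
  unfolding admissible_def
proof (intro allI impI)
  fix X :: "'x topology" and G
  assume G: "continuous_map X t G"
  have "continuous_map (prod_topology X Y) (prod_topology t Y) (\<lambda>(x, y). (G x, y))"
    using continuous_map_compose [OF continuous_map_fst G, of Y]
    by (simp add: continuous_map_pairwise o_def case_prod_unfold continuous_map_snd)
  from continuous_map_compose [OF this assms]
  show "continuous_map (prod_topology X Y) Z (\<lambda>(x, y). G x y)"
    by (simp add: o_def case_prod_unfold)
qed

lemma evaluation_if_admissible:
  fixes t :: "('a \<Rightarrow> 'b) topology"
  assumes "admissible TYPE('a \<Rightarrow> 'b) Y Z t"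
  shows "continuous_map (prod_topology t Y) Z (\<lambda>(f, y). f y)"
  using assms continuous_map_id [of t, unfolded id_def] unfolding admissible_def by blast

end

theory Submission
  imports Defs
begin

text \<open>
  Double dualisation preserves admissibility: if \<open>\<H> \<times> V\<close> is a neighbourhood of \<open>(f, y)\<close> that
  evaluation maps into \<open>U\<close>, then every member of the open set \<open>{g\<^sup>-\<^sup>1(U) | g \<in> \<H>}\<close> of \<open>\<tau>(t)\<close> contains
  \<open>V\<close>, so evaluation also maps \<open>{g | g\<^sup>-\<^sup>1(U) \<in> {h\<^sup>-\<^sup>1(U) | h \<in> \<H>}} \<times> V\<close> into \<open>U\<close>. It remains to see that
  the original topologies are admissible. Given \<open>f(y) \<in> U\<close>, one needs a family \<open>H \<ni> f\<^sup>-\<^sup>1(U)\<close> in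
  \<open>\<tau>\<^sub>1\<close> or \<open>\<tau>\<^sub>1\<^sub>,\<^sub>s\<close> whose members all contain a fixed neighbourhood of \<open>y\<close>: the open
  supersets of a \<open>Z\<close>-compact or bounded neighbourhood, or, when \<open>Y\<close> is corecompact, the open sets
  in which a neighbourhood is bounded, where \<open>(\<beta>)\<close> is the interpolation property of the relation
  ``bounded in''. \<open>Z\<close>-corecompactness and local \<open>Z\<close>-boundedness force \<open>\<tau>\<^sub>Y\<^sup>Z\<close> to be the topology
  of \<open>Y\<close>, so they reduce to the properties without \<open>Z\<close>.
\<close>

section \<open>Comparison of the topology of \<open>Y\<close> with \<open>tauYZ Y Z\<close>\<close>

lemma openin_topology_with_subbasis:
  assumes "B \<in> \<B>" "B \<subseteq> S"
  shows "openin (topology_with_subbasis S \<B>) B"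
proof -
  have "(finite intersection_of (\<lambda>B. B \<in> \<B>) relative_to S) B"
    using assms by (metis finite_intersection_of_inc inf.absorb_iff2 relative_to_def)
  then show ?thesis
    by (simp add: topology_with_subbasis_def openin_subbase arbitrary_union_of_inc)
qed

lemma topspace_t_co [simp]: "topspace (t_co Y Z) = cmaps Y Z"
  by (simp add: t_co_def)

lemma topspace_t_of_family [simp]: "topspace (t_of_family Y Z \<T>) = cmaps Y Z"
  by (simp add: t_of_family_def)

lemma topspace_tauYZ [simp]: "topspace (tauYZ Y Z) = topspace Y"
  by (simp add: tauYZ_def)

lemma openin_preim: "f \<in> cmaps Y Z \<Longrightarrow> openin Z U \<Longrightarrow> openin Y (preim Y f U)"
  unfolding cmaps_def preim_def by (blast intro: openin_continuous_map_preimage)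

lemma openin_OZ: "A \<in> OZ Y Z \<Longrightarrow> openin Y A"
  by (auto simp: OZ_def openin_preim)

lemma openin_tauYZ_OZ: "A \<in> OZ Y Z \<Longrightarrow> openin (tauYZ Y Z) A"
  unfolding tauYZ_def by (simp add: openin_topology_with_subbasis openin_subset openin_OZ)

lemma openin_tauYZ_imp_openin:
  assumes "openin (tauYZ Y Z) S"
  shows "openin Y S"
proof (rule minimal_topology_subbase)
  show "openin (topology (arbitrary union_of
          (finite intersection_of (\<lambda>B. B \<in> OZ Y Z) relative_to topspace Y))) S"
    using assms by (simp add: tauYZ_def topology_with_subbasis_def)
qed (auto simp: openin_OZ)

text \<open>\<open>tauYZ Y Z\<close> is coarser than \<open>Y\<close>, so it has fewer open covers
  to test.\<close>

lemma Z_compact_if_compactin: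
  assumes "compactin Y K"
  shows "Z_compact Y Z K"
  using assms openin_tauYZ_imp_openin[of Y Z]
  by (simp add: Z_compact_def compactin_def)

text \<open>The assumption makes \<open>OZ Y Z\<close> a base of \<open>Y\<close>. Local
  \<open>Z\<close>-boundedness and \<open>Z\<close>-corecompactness supply it because they ask for a
  member of \<open>OZ Y Z\<close> inside every open set of \<open>Y\<close>, not only inside those
  open in \<open>tauYZ Y Z\<close>.\<close>

lemma tauYZ_eq_if_OZ_base:
  assumes "\<And>y U. openin Y U \<Longrightarrow> y \<in> U \<Longrightarrow> \<exists>A\<in>OZ Y Z. y \<in> A \<and> A \<subseteq> U"
  shows "tauYZ Y Z = Y"
  unfolding topology_eq
proof (intro allI iffI)
  fix S
  assume S: "openin Y S"
  have "\<exists>T. openin (tauYZ Y Z) T \<and> y \<in> T \<and> T \<subseteq> S" if "y \<in> S" for y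
    using assms[OF S that] openin_tauYZ_OZ by fast
  then show "openin (tauYZ Y Z) S"
    by (subst openin_subopen) fast
qed (rule openin_tauYZ_imp_openin)

lemma Z_corecompact_imp_corecompact:
  assumes "Z_corecompact Y Z"
  shows "corecompact Y"
proof -
  have "\<exists>A\<in>OZ Y Z. y \<in> A \<and> A \<subseteq> U" if "openin Y U" "y \<in> U" for y U
    using assms that openin_subset unfolding Z_corecompact_def by (meson subsetD)
  then have "tauYZ Y Z = Y"
    by (rule tauYZ_eq_if_OZ_base)
  then show ?thesis
    using assms openin_OZ unfolding Z_corecompact_def corecompact_def by metis
qed

lemma locally_Z_bounded_imp_locally_bounded:
  assumes "locally_Z_bounded Y Z"
  shows "locally_bounded Y"
proof -
  have "\<exists>A\<in>OZ Y Z. y \<in> A \<and> A \<subseteq> U" if "openin Y U" "y \<in> U" for y U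
    using assms that openin_subset unfolding locally_Z_bounded_def by (meson subsetD)
  then have "tauYZ Y Z = Y"
    by (rule tauYZ_eq_if_OZ_base)
  then show ?thesis
    using assms openin_OZ unfolding locally_Z_bounded_def Z_bounded_def locally_bounded_def
    by metis
qed

section \<open>Continuity of evaluation and double dualisation\<close>

text \<open>Continuity is tested on boxes around each point. In the condition on a box,
  \<open>g\<close> enters only through its preimage of \<open>U\<close>, and this is what
  dualisation preserves.\<close>

lemma continuous_evaluation_iff:
  assumes "topspace t = cmaps Y Z"
  shows "continuous_map (prod_topology t Y) Z (\<lambda>(f, y). f y) \<longleftrightarrow>
    (\<forall>f\<in>cmaps Y Z. \<forall>U y. openin Z U \<and> y \<in> preim Y f U \<longrightarrow>
      (\<exists>\<H> V. openin t \<H> \<and> f \<in> \<H> \<and> openin Y V \<and> y \<in> V \<and> (\<forall>g\<in>\<H>. V \<subseteq> preim Y g U)))"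
    (is "?cont \<longleftrightarrow> ?nbhds")
proof
  assume cont: ?cont
  show ?nbhds
  proof (intro ballI allI impI, elim conjE)
    fix f U y
    assume f: "f \<in> cmaps Y Z" and U: "openin Z U" and y: "y \<in> preim Y f U"
    define E where "E = {p \<in> topspace (prod_topology t Y). (case p of (f, y) \<Rightarrow> f y) \<in> U}"
    have "openin (prod_topology t Y) E"
      unfolding E_def using cont U by (rule openin_continuous_map_preimage)
    moreover have "(f, y) \<in> E"
      using f y assms by (simp add: E_def preim_def)
    ultimately have "\<exists>\<H> V. openin t \<H> \<and> openin Y V \<and> f \<in> \<H> \<and> y \<in> V \<and> \<H> \<times> V \<subseteq> E"
      unfolding openin_prod_topology_alt by (elim allE impE)
    then obtain \<H> V where HV: "openin t \<H>" "openin Y V" "f \<in> \<H>" "y \<in> V" "\<H> \<times> V \<subseteq> E"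
      by (elim exE conjE)
    then have "\<forall>g\<in>\<H>. V \<subseteq> preim Y g U"
      by (auto simp: E_def preim_def)
    with HV show "\<exists>\<H> V. openin t \<H> \<and> f \<in> \<H> \<and> openin Y V \<and> y \<in> V \<and> (\<forall>g\<in>\<H>. V \<subseteq> preim Y g U)"
      by blast
  qed
next
  assume nbhds: ?nbhds
  show ?cont
    unfolding continuous_map_def
  proof (intro conjI allI impI)
    show "(\<lambda>(f, y). f y) \<in> topspace (prod_topology t Y) \<rightarrow> topspace Z"
      using assms by (auto simp: cmaps_def continuous_map_def)
  next
    fix U
    assume U: "openin Z U"
    show "openin (prod_topology t Y)
            {p \<in> topspace (prod_topology t Y). (case p of (f, y) \<Rightarrow> f y) \<in> U}"
      unfolding openin_prod_topology_alt
    proof (intro allI impI)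
      fix f y
      assume "(f, y) \<in> {p \<in> topspace (prod_topology t Y). (case p of (f, y) \<Rightarrow> f y) \<in> U}"
      then have "f \<in> cmaps Y Z" "y \<in> preim Y f U"
        using assms by (auto simp: preim_def)
      then obtain \<H> V where HV: "openin t \<H>" "f \<in> \<H>" "openin Y V" "y \<in> V"
          "\<forall>g\<in>\<H>. V \<subseteq> preim Y g U"
        using nbhds U by meson
      then have "\<H> \<times> V \<subseteq> {p \<in> topspace (prod_topology t Y). (case p of (f, y) \<Rightarrow> f y) \<in> U}"
        using openin_subset[of t \<H>] by (auto simp: preim_def)
      with HV show "\<exists>\<H> V. openin t \<H> \<and> openin Y V \<and> f \<in> \<H> \<and> y \<in> V \<and>
          \<H> \<times> V \<subseteq> {p \<in> topspace (prod_topology t Y). (case p of (f, y) \<Rightarrow> f y) \<in> U}"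
        by blast
    qed
  qed
qed

text \<open>The subbasic set given by \<open>H\<close> and \<open>U\<close> is the required
  neighbourhood of \<open>f\<close>: the preimages of \<open>U\<close> under its elements lie in
  \<open>H\<close>, hence contain \<open>V\<close>.\<close>

lemma continuous_evaluation_t_of_family:
  assumes "\<And>f U y. f \<in> cmaps Y Z \<Longrightarrow> openin Z U \<Longrightarrow> y \<in> preim Y f U \<Longrightarrow>
    \<exists>H\<in>\<T>. preim Y f U \<in> H \<and> (\<exists>V. openin Y V \<and> y \<in> V \<and> (\<forall>W\<in>H. V \<subseteq> W))"
  shows "continuous_map (prod_topology (t_of_family Y Z \<T>) Y) Z (\<lambda>(f, y). f y)"
  unfolding continuous_evaluation_iff[OF topspace_t_of_family]
proof (intro ballI allI impI, elim conjE)
  fix f U y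
  assume f: "f \<in> cmaps Y Z" and U: "openin Z U" and y: "y \<in> preim Y f U"
  then obtain H V where H: "H \<in> \<T>" "preim Y f U \<in> H"
      and V: "openin Y V" "y \<in> V" "\<forall>W\<in>H. V \<subseteq> W"
    using assms[OF f U y] by blast
  let ?\<H> = "{g \<in> cmaps Y Z. preim Y g U \<in> H}"
  have "openin (t_of_family Y Z \<T>) ?\<H>"
    unfolding t_of_family_def using H U by (intro openin_topology_with_subbasis) auto
  then show "\<exists>\<H> V. openin (t_of_family Y Z \<T>) \<H> \<and> f \<in> \<H> \<and> openin Y V \<and> y \<in> V \<and>
      (\<forall>g\<in>\<H>. V \<subseteq> preim Y g U)"
    using f H V by (intro exI[of _ ?\<H>] exI[of _ V]) auto
qed

lemma admissible_dual_dual: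
  assumes t: "topspace t = cmaps Y Z"
    and cont: "continuous_map (prod_topology t Y) Z (\<lambda>(f, y). f y)"
  shows "admissible TYPE('x) Y Z (dual_t Y Z (dual_tau Y Z t))"
  unfolding dual_t_def
proof (intro admissible_if_evaluation continuous_evaluation_t_of_family)
  fix f U y
  assume "f \<in> cmaps Y Z" and U: "openin Z U" and "y \<in> preim Y f U"
  then obtain \<H> V where H: "openin t \<H>" "f \<in> \<H>"
      and V: "openin Y V" "y \<in> V" "\<forall>g\<in>\<H>. V \<subseteq> preim Y g U"
    using cont unfolding continuous_evaluation_iff[OF t] by meson
  \<comment> \<open>This is a subbasic open set of \<open>dual_tau Y Z t\<close>, taken with the
    same \<open>U\<close>. A map outside \<open>\<H>\<close> may also have its preimage of
    \<open>U\<close> in it, which is harmless since that set still contains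
    \<open>V\<close>.\<close>
  let ?H = "{preim Y g U | g. g \<in> \<H>}"
  have "\<H> \<subseteq> cmaps Y Z"
    using openin_subset[OF H(1)] t by simp
  then have "openin (dual_tau Y Z t) ?H"
    unfolding dual_tau_def using H U
    by (intro openin_topology_with_subbasis) (auto simp: OZ_def)
  then show "\<exists>H\<in>Collect (openin (dual_tau Y Z t)). preim Y f U \<in> H \<and>
      (\<exists>V. openin Y V \<and> y \<in> V \<and> (\<forall>W\<in>H. V \<subseteq> W))"
    using H V by (intro bexI[of _ ?H]) auto
qed

text \<open>Condition (\<beta>) speaks only of unions that belong to \<open>H\<close>, so it applies
  to covers of \<open>Y\<close> once \<open>Y\<close> itself belongs to \<open>H\<close>.\<close>

lemma tau1_in_tau1s:
  assumes "H \<in> tau1 Y Z" "topspace Y \<in> H"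
  shows "H \<in> tau1s Y Z"
  using assms by (auto simp: tau1_def tau1s_def)

text \<open>One construction serves both topologies: the preimage of \<open>U\<close> under
  \<open>f\<close> is a member of \<open>OZ Y Z\<close> in \<open>H\<close>, so (\<alpha>) puts
  \<open>Y\<close> into \<open>H\<close>, and \<open>H\<close> lies in \<open>tau1s Y Z\<close>
  too.\<close>

lemma continuous_evaluation_t_1_t_1s:
  assumes "\<And>f U y. f \<in> cmaps Y Z \<Longrightarrow> openin Z U \<Longrightarrow> y \<in> preim Y f U \<Longrightarrow>
    \<exists>H\<in>tau1 Y Z. preim Y f U \<in> H \<and> (\<exists>V. openin Y V \<and> y \<in> V \<and> (\<forall>W\<in>H. V \<subseteq> W))"
  shows "continuous_map (prod_topology (t_1 Y Z) Y) Z (\<lambda>(f, y). f y)"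
    and "continuous_map (prod_topology (t_1s Y Z) Y) Z (\<lambda>(f, y). f y)"
proof -
  show "continuous_map (prod_topology (t_1 Y Z) Y) Z (\<lambda>(f, y). f y)"
    unfolding t_1_def using assms by (rule continuous_evaluation_t_of_family)
  show "continuous_map (prod_topology (t_1s Y Z) Y) Z (\<lambda>(f, y). f y)"
    unfolding t_1s_def
  proof (rule continuous_evaluation_t_of_family)
    fix f U y
    assume f: "f \<in> cmaps Y Z" and U: "openin Z U" and y: "y \<in> preim Y f U"
    then obtain H where H: "H \<in> tau1 Y Z" "preim Y f U \<in> H"
        and V: "\<exists>V. openin Y V \<and> y \<in> V \<and> (\<forall>W\<in>H. V \<subseteq> W)"
      using assms[OF f U y] by blast
    have "preim Y f U \<in> OZ Y Z" "preim Y f U \<subseteq> topspace Y"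
      using f U by (auto simp: OZ_def preim_def)
    with H have "topspace Y \<in> H"
      unfolding tau1_def cond_alpha_def by blast
    then show "\<exists>H\<in>tau1s Y Z. preim Y f U \<in> H \<and> (\<exists>V. openin Y V \<and> y \<in> V \<and> (\<forall>W\<in>H. V \<subseteq> W))"
      using H V tau1_in_tau1s by blast
  qed
qed

section \<open>Local compactness and local \<open>Z\<close>-compactness\<close>

text \<open>\<open>A\<close> is taken from \<open>OZ Y Z\<close> because local
  \<open>Z\<close>-compactness gives small neighbourhoods only inside sets open in
  \<open>tauYZ Y Z\<close>. For evaluation it is enough that \<open>V\<close> is open in the finer
  topology of \<open>Y\<close>.\<close>

lemma Z_compact_neighbourhood:
  assumes "locally_compact_top Y \<or> locally_Z_compact Y Z"
    and A: "A \<in> OZ Y Z" "y \<in> A"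
  obtains V K where "openin Y V" "y \<in> V" "V \<subseteq> K" "K \<subseteq> A" "Z_compact Y Z K"
  using assms(1)
proof
  assume "locally_compact_top Y"
  then obtain V K where "openin Y V" "compactin Y K" "y \<in> V" "V \<subseteq> K" "K \<subseteq> A"
    using A openin_OZ unfolding locally_compact_top_def neighbourhood_base_of by metis
  then show thesis
    using that Z_compact_if_compactin by blast
next
  assume "locally_Z_compact Y Z"
  then obtain V K where "openin (tauYZ Y Z) V" "compactin (tauYZ Y Z) K" "y \<in> V" "V \<subseteq> K" "K \<subseteq> A"
    using A openin_tauYZ_OZ
    unfolding locally_Z_compact_def locally_compact_top_def neighbourhood_base_of by metis
  then show thesis
    using that openin_tauYZ_imp_openin unfolding Z_compact_def by blast
qed

lemma continuous_evaluation_t_co: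
  assumes "locally_compact_top Y \<or> locally_Z_compact Y Z"
  shows "continuous_map (prod_topology (t_co Y Z) Y) Z (\<lambda>(f, y). f y)"
  unfolding continuous_evaluation_iff[OF topspace_t_co]
proof (intro ballI allI impI, elim conjE)
  fix f U y
  assume f: "f \<in> cmaps Y Z" and U: "openin Z U" and y: "y \<in> preim Y f U"
  then have "preim Y f U \<in> OZ Y Z"
    unfolding OZ_def by blast
  then obtain V K where V: "openin Y V" "y \<in> V" "V \<subseteq> K"
      and K: "K \<subseteq> preim Y f U" "Z_compact Y Z K"
    using y by (rule Z_compact_neighbourhood[OF assms])
  let ?\<H> = "{g \<in> cmaps Y Z. g ` K \<subseteq> U}"
  have KY: "K \<subseteq> topspace Y"
    using K by (auto simp: preim_def)
  then have "openin (t_co Y Z) ?\<H>"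
    unfolding t_co_def using K U by (intro openin_topology_with_subbasis) auto
  then show "\<exists>\<H> V. openin (t_co Y Z) \<H> \<and> f \<in> \<H> \<and> openin Y V \<and> y \<in> V \<and>
      (\<forall>g\<in>\<H>. V \<subseteq> preim Y g U)"
    using f K KY V by (intro exI[of _ ?\<H>] exI[of _ V]) (auto simp: preim_def image_subset_iff)
qed

text \<open>Members of \<open>OZ Y Z\<close> are open in \<open>tauYZ Y Z\<close>, so (\<beta>) is
  the finite subcover property of \<open>K\<close> there.\<close>

lemma open_supersets_in_tau1:
  assumes "Z_compact Y Z K"
  shows "{W. openin Y W \<and> K \<subseteq> W} \<in> tau1 Y Z"
proof -
  have "\<exists>\<F>\<subseteq>\<A>. finite \<F> \<and> openin Y (\<Union>\<F>) \<and> K \<subseteq> \<Union>\<F>"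
    if \<A>: "\<A> \<subseteq> OZ Y Z" "K \<subseteq> \<Union>\<A>" for \<A>
  proof -
    obtain \<F> where "finite \<F>" "\<F> \<subseteq> \<A>" "K \<subseteq> \<Union>\<F>"
      using assms \<A> openin_tauYZ_OZ unfolding Z_compact_def compactin_def by (metis subsetD)
    then show ?thesis
      using \<A> openin_OZ by (metis openin_Union subsetD)
  qed
  then show ?thesis
    by (auto simp: tau1_def cond_alpha_def)
qed

lemma continuous_evaluation_locally_compact:
  assumes "locally_compact_top Y \<or> locally_Z_compact Y Z"
  shows "continuous_map (prod_topology (t_1 Y Z) Y) Z (\<lambda>(f, y). f y)"
    and "continuous_map (prod_topology (t_1s Y Z) Y) Z (\<lambda>(f, y). f y)"
proof -
  have nbhd: "\<exists>H\<in>tau1 Y Z. preim Y f U \<in> H \<and> (\<exists>V. openin Y V \<and> y \<in> V \<and> (\<forall>W\<in>H. V \<subseteq> W))"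
    if f: "f \<in> cmaps Y Z" and U: "openin Z U" and y: "y \<in> preim Y f U" for f U y
  proof -
    have "preim Y f U \<in> OZ Y Z"
      using f U unfolding OZ_def by blast
    then obtain V K where "openin Y V" "y \<in> V" "V \<subseteq> K"
        and "K \<subseteq> preim Y f U" "Z_compact Y Z K"
      using y by (rule Z_compact_neighbourhood[OF assms])
    then show ?thesis
      using openin_preim[OF f U]
      by (intro bexI[OF _ open_supersets_in_tau1[of Y Z K]]) auto
  qed
  show "continuous_map (prod_topology (t_1 Y Z) Y) Z (\<lambda>(f, y). f y)"
    using nbhd by (rule continuous_evaluation_t_1_t_1s(1))
  show "continuous_map (prod_topology (t_1s Y Z) Y) Z (\<lambda>(f, y). f y)"
    using nbhd by (rule continuous_evaluation_t_1_t_1s(2))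
qed

section \<open>Relative boundedness and corecompactness\<close>

lemma bounded_in_subtopology_subset: "bounded_in (subtopology Y U) V \<Longrightarrow> V \<subseteq> U"
  by (auto simp: bounded_in_def)

text \<open>Covers by open sets of \<open>Y\<close> that may stick out of \<open>U\<close> become
  covers of the subspace by intersecting with \<open>U\<close>. In this form covers for different
  \<open>U\<close> can be compared.\<close>

lemma bounded_in_open_subtopology:
  assumes "openin Y U"
  shows "bounded_in (subtopology Y U) V \<longleftrightarrow> V \<subseteq> U \<and>
    (\<forall>\<U>. (\<forall>W\<in>\<U>. openin Y W) \<and> U \<subseteq> \<Union>\<U> \<longrightarrow> (\<exists>\<F>\<subseteq>\<U>. finite \<F> \<and> V \<subseteq> \<Union>\<F>))"
    (is "?bd \<longleftrightarrow> V \<subseteq> U \<and> ?cov")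
proof -
  have top: "topspace (subtopology Y U) = U"
    using assms openin_subset by auto
  show ?thesis
  proof
    assume bd: ?bd
    then have VU: "V \<subseteq> U"
      using top by (simp add: bounded_in_def)
    have "\<exists>\<F>\<subseteq>\<U>. finite \<F> \<and> V \<subseteq> \<Union>\<F>" if \<U>: "\<forall>W\<in>\<U>. openin Y W" "U \<subseteq> \<Union>\<U>" for \<U>
    proof -
      have "\<forall>W \<in> (\<inter>) U ` \<U>. openin (subtopology Y U) W"
        using \<U> by (auto simp: openin_subtopology_Int2)
      moreover have "\<Union>((\<inter>) U ` \<U>) = topspace (subtopology Y U)"
        using \<U> top by blast
      ultimately obtain \<G> where "\<G> \<subseteq> (\<inter>) U ` \<U>" "finite \<G>" "V \<subseteq> \<Union>\<G>"
        using bd unfolding bounded_in_def by meson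
      \<comment> \<open>The finite subcover consists of traces on \<open>U\<close>; it is lifted
        back to members of \<open>\<U>\<close>.\<close>
      then obtain \<F> where "\<F> \<subseteq> \<U>" "finite \<F>" "\<G> = (\<inter>) U ` \<F>"
        by (meson finite_subset_image)
      with \<open>V \<subseteq> \<Union>\<G>\<close> show ?thesis
        by (intro exI[of _ \<F>]) auto
    qed
    with VU show "V \<subseteq> U \<and> ?cov"
      by blast
  next
    assume "V \<subseteq> U \<and> ?cov"
    then show ?bd
      unfolding bounded_in_def top openin_open_subtopology[OF assms]
      by (metis order_refl)
  qed
qed

text \<open>Every cover of \<open>W\<close> also covers \<open>U\<close>.\<close>

lemma bounded_in_subtopology_mono:
  assumes "bounded_in (subtopology Y U) V" "openin Y U" "openin Y W" "U \<subseteq> W"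
  shows "bounded_in (subtopology Y W) V"
  using assms(1) subset_trans[OF assms(4)]
  unfolding bounded_in_open_subtopology[OF assms(2)] bounded_in_open_subtopology[OF assms(3)]
  by (meson assms(4) subset_trans)

lemma bounded_in_subset:
  assumes "bounded_in X V" "V' \<subseteq> V"
  shows "bounded_in X V'"
  using assms unfolding bounded_in_def by (meson subset_trans)

lemma bounded_in_Union:
  assumes "finite \<V>" "\<forall>V\<in>\<V>. bounded_in X V"
  shows "bounded_in X (\<Union>\<V>)"
  unfolding bounded_in_def
proof (intro conjI allI impI)
  show "\<Union>\<V> \<subseteq> topspace X"
    using assms unfolding bounded_in_def by blast
next
  fix \<U>
  assume "(\<forall>U\<in>\<U>. openin X U) \<and> \<Union>\<U> = topspace X"
  then have "\<forall>V\<in>\<V>. \<exists>\<F>. \<F> \<subseteq> \<U> \<and> finite \<F> \<and> V \<subseteq> \<Union>\<F>"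
    using assms(2) unfolding bounded_in_def by meson
  then obtain F where F: "\<forall>V\<in>\<V>. F V \<subseteq> \<U> \<and> finite (F V) \<and> V \<subseteq> \<Union>(F V)"
    using bchoice by meson
  then show "\<exists>\<F>\<subseteq>\<U>. finite \<F> \<and> \<Union>\<V> \<subseteq> \<Union>\<F>"
    using assms(1) by (intro exI[of _ "\<Union>(F ` \<V>)"]) fastforce
qed

text \<open>Corecompactness, used twice at each point of \<open>U\<close>, gives neighbourhoods
  \<open>P\<close> bounded in \<open>Q\<close> and \<open>Q\<close> bounded in \<open>U\<close>.
  Finitely many \<open>P\<close> cover \<open>V\<close>, and the union of their partners
  \<open>Q\<close> is the interpolant.\<close>

lemma corecompact_interpolation:
  assumes cc: "corecompact Y" and U: "openin Y U" and bd: "bounded_in (subtopology Y U) V"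
  obtains W where "openin Y W" "bounded_in (subtopology Y U) W" "bounded_in (subtopology Y W) V"
proof -
  have step: "\<exists>W. openin Y W \<and> x \<in> W \<and> W \<subseteq> S \<and> bounded_in (subtopology Y S) W"
    if "openin Y S" "x \<in> S" for S x
    using cc that openin_subset unfolding corecompact_def by blast
  \<comment> \<open>Pairs are recorded so that each \<open>P\<close> in the finite subcover comes
    with a partner \<open>Q\<close>.\<close>
  define \<V> where "\<V> = {(P, Q). openin Y P \<and> openin Y Q \<and>
    bounded_in (subtopology Y Q) P \<and> bounded_in (subtopology Y U) Q}"
  have "\<forall>P\<in>fst ` \<V>. openin Y P"
    by (auto simp: \<V>_def)
  moreover have "U \<subseteq> \<Union>(fst ` \<V>)"
  proof
    fix x
    assume "x \<in> U"
    then obtain Q where Q: "openin Y Q" "x \<in> Q" "bounded_in (subtopology Y U) Q"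
      using step U by blast
    moreover obtain P where "openin Y P" "x \<in> P" "bounded_in (subtopology Y Q) P"
      using step Q by blast
    ultimately have "(P, Q) \<in> \<V>" "x \<in> P"
      by (auto simp: \<V>_def)
    then show "x \<in> \<Union>(fst ` \<V>)"
      by force
  qed
  ultimately obtain \<F>' where "\<F>' \<subseteq> fst ` \<V>" "finite \<F>'" "V \<subseteq> \<Union>\<F>'"
    using bd unfolding bounded_in_open_subtopology[OF U] by meson
  then obtain \<F> where \<F>: "\<F> \<subseteq> \<V>" "finite \<F>" "V \<subseteq> \<Union>(fst ` \<F>)"
    by (metis finite_subset_image)
  let ?W = "\<Union>(snd ` \<F>)"
  have \<F>_\<V>: "openin Y Q" "bounded_in (subtopology Y Q) P" "bounded_in (subtopology Y U) Q"
    if "(P, Q) \<in> \<F>" for P Q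
    using \<F>(1) that by (auto simp: \<V>_def)
  have W: "openin Y ?W"
    using \<F>_\<V> by (intro openin_Union) auto
  have "bounded_in (subtopology Y U) ?W"
    using \<F>(2) \<F>_\<V> by (intro bounded_in_Union) auto
  moreover have "bounded_in (subtopology Y ?W) P" if "(P, Q) \<in> \<F>" for P Q
    using \<F>_\<V>(2)[OF that] \<F>_\<V>(1)[OF that] W
    by (rule bounded_in_subtopology_mono) (use that in force)
  then have "bounded_in (subtopology Y ?W) (\<Union>(fst ` \<F>))"
    using \<F>(2) by (intro bounded_in_Union) auto
  then have "bounded_in (subtopology Y ?W) V"
    using \<F> bounded_in_subset by blast
  ultimately show thesis
    using that W by blast
qed

text \<open>(\<alpha>) is monotonicity. For (\<beta>), merely covering \<open>V\<close> by finitely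
  many members of \<open>\<A>\<close> would not make \<open>V\<close> bounded in their union.
  Instead an interpolant \<open>W\<close> is covered; since \<open>V\<close> is bounded in
  \<open>W\<close>, it is bounded in any larger open set.\<close>

lemma bounding_sets_in_tau1:
  assumes cc: "corecompact Y"
  shows "{W. openin Y W \<and> bounded_in (subtopology Y W) V} \<in> tau1 Y Z"
proof -
  have "\<exists>\<F>\<subseteq>\<A>. finite \<F> \<and> openin Y (\<Union>\<F>) \<and> bounded_in (subtopology Y (\<Union>\<F>)) V"
    if \<A>: "\<A> \<subseteq> OZ Y Z" "openin Y (\<Union>\<A>)" "bounded_in (subtopology Y (\<Union>\<A>)) V" for \<A>
  proof -
    obtain W where W: "openin Y W" "bounded_in (subtopology Y (\<Union>\<A>)) W"
        "bounded_in (subtopology Y W) V"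
      using corecompact_interpolation[OF cc \<A>(2,3)] .
    obtain \<F> where \<F>: "\<F> \<subseteq> \<A>" "finite \<F>" "W \<subseteq> \<Union>\<F>"
      using W(2) \<A>(1) openin_OZ unfolding bounded_in_open_subtopology[OF \<A>(2)]
      by (metis order_refl subsetD)
    moreover have "openin Y (\<Union>\<F>)"
      using \<F> \<A>(1) openin_OZ by (metis openin_Union subsetD)
    ultimately show ?thesis
      using bounded_in_subtopology_mono[OF W(3,1)] by meson
  qed
  then show ?thesis
    by (auto simp: tau1_def cond_alpha_def intro: bounded_in_subtopology_mono)
qed

lemma continuous_evaluation_corecompact:
  assumes cc: "corecompact Y"
  shows "continuous_map (prod_topology (t_1 Y Z) Y) Z (\<lambda>(f, y). f y)"
    and "continuous_map (prod_topology (t_1s Y Z) Y) Z (\<lambda>(f, y). f y)"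
proof -
  have nbhd: "\<exists>H\<in>tau1 Y Z. preim Y f U \<in> H \<and> (\<exists>V. openin Y V \<and> y \<in> V \<and> (\<forall>W\<in>H. V \<subseteq> W))"
    if f: "f \<in> cmaps Y Z" and U: "openin Z U" and y: "y \<in> preim Y f U" for f U y
  proof -
    have A: "openin Y (preim Y f U)" "y \<in> topspace Y"
      using f U y openin_preim by (auto simp: preim_def)
    then obtain V where "openin Y V" "y \<in> V" "bounded_in (subtopology Y (preim Y f U)) V"
      using cc y unfolding corecompact_def by meson
    then show ?thesis
      using A by (intro bexI[OF _ bounding_sets_in_tau1[OF cc, of V]])
        (auto dest: bounded_in_subtopology_subset)
  qed
  show "continuous_map (prod_topology (t_1 Y Z) Y) Z (\<lambda>(f, y). f y)"
    using nbhd by (rule continuous_evaluation_t_1_t_1s(1))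
  show "continuous_map (prod_topology (t_1s Y Z) Y) Z (\<lambda>(f, y). f y)"
    using nbhd by (rule continuous_evaluation_t_1_t_1s(2))
qed

section \<open>Local boundedness and conclusion\<close>

text \<open>(\<beta>') concerns only covers of all of \<open>Y\<close>, which is what boundedness in
  \<open>Y\<close> controls. A collection covering \<open>K\<close> but not \<open>Y\<close> is out
  of its reach, so this argument does not give (\<beta>).\<close>

lemma open_supersets_in_tau1s:
  assumes "bounded_in Y K"
  shows "{W. openin Y W \<and> K \<subseteq> W} \<in> tau1s Y Z"
proof -
  have "\<exists>\<F>\<subseteq>\<A>. finite \<F> \<and> openin Y (\<Union>\<F>) \<and> K \<subseteq> \<Union>\<F>"
    if \<A>: "\<A> \<subseteq> OZ Y Z" "\<Union>\<A> = topspace Y" for \<A>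
  proof -
    obtain \<F> where "finite \<F>" "\<F> \<subseteq> \<A>" "K \<subseteq> \<Union>\<F>"
      using assms \<A> openin_OZ unfolding bounded_in_def by (metis subsetD)
    then show ?thesis
      using \<A> openin_OZ by (metis openin_Union subsetD)
  qed
  then show ?thesis
    by (auto simp: tau1s_def cond_alpha_def)
qed

lemma continuous_evaluation_locally_bounded:
  assumes "locally_bounded Y"
  shows "continuous_map (prod_topology (t_1s Y Z) Y) Z (\<lambda>(f, y). f y)"
  unfolding t_1s_def
proof (rule continuous_evaluation_t_of_family)
  fix f U y
  assume "f \<in> cmaps Y Z" "openin Z U" and y: "y \<in> preim Y f U"
  then have A: "openin Y (preim Y f U)" "y \<in> topspace Y"
    using openin_preim by (auto simp: preim_def)
  then obtain V where "openin Y V" "y \<in> V" "V \<subseteq> preim Y f U" "bounded_in Y V"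
    using assms y unfolding locally_bounded_def by meson
  then show "\<exists>H\<in>tau1s Y Z. preim Y f U \<in> H \<and> (\<exists>V. openin Y V \<and> y \<in> V \<and> (\<forall>W\<in>H. V \<subseteq> W))"
    using A by (intro bexI[OF _ open_supersets_in_tau1s[of Y V]]) auto
qed

theorem corollary3p2:
  fixes Y :: "'a topology" and Z :: "'b topology"
  shows
    "(regular_space Y \<and> (locally_compact_top Y \<or> locally_Z_compact Y Z) \<longrightarrow>
        admissible TYPE('x) Y Z (dual_t Y Z (dual_tau Y Z (t_co Y Z))) \<and>
        admissible TYPE('x) Y Z (dual_t Y Z (dual_tau Y Z (t_1 Y Z))) \<and>
        admissible TYPE('x) Y Z (dual_t Y Z (dual_tau Y Z (t_1s Y Z)))) \<and>
     (corecompact Y \<or> Z_corecompact Y Z \<longrightarrow>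
        admissible TYPE('x) Y Z (dual_t Y Z (dual_tau Y Z (t_1 Y Z))) \<and>
        admissible TYPE('x) Y Z (dual_t Y Z (dual_tau Y Z (t_1s Y Z)))) \<and>
     (locally_bounded Y \<or> locally_Z_bounded Y Z \<longrightarrow>
        admissible TYPE('x) Y Z (dual_t Y Z (dual_tau Y Z (t_1s Y Z))))"
proof -
  have top: "topspace (t_1 Y Z) = cmaps Y Z" "topspace (t_1s Y Z) = cmaps Y Z"
    by (simp_all add: t_1_def t_1s_def)
  show ?thesis
    using continuous_evaluation_t_co continuous_evaluation_locally_compact
      continuous_evaluation_corecompact Z_corecompact_imp_corecompact
      continuous_evaluation_locally_bounded locally_Z_bounded_imp_locally_bounded
      admissible_dual_dual[OF topspace_t_co] admissible_dual_dual[OF top(1)]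
      admissible_dual_dual[OF top(2)]
    by meson
qed

end
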